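(* Let $m\le n$ and $k\le m$ be positive integers, and assume that the index vectors $\bar{p}_1,\dots,\bar{p}_k$ are all $v$-dimensional with $v=m/k\in\mathbb{N}$. Then the computational cost required by the Surrogate $k$-fold CV algorithm described in the context, on input $m\times n$ matrices $\mathsf{G},\mathsf{L}$ and vectors $\bar{g},\bar{h}\in\mathbb{R}^m$, is $$\mathcal{O}(mn^2)+\mathcal{O}\left(\frac{m^3+m^2nk+mn^2k^2}{k^2}\right).$$
   Context: Surrogate $k$-fold CV algorithm. Input: real $m\times n$ matrices $\mathsf{G}$ and $\mathsf{L}$ (collocation and evaluation matrices for $m$ collocation points and $n\ge m$ centers, the first $m$ columns corresponding to centers equal to the collocation points), vectors $\bar{g},\bar{h}\in\mathbb{R}^m$, and the number of folds $k$. Output: $\bar{\epsilon}\in\mathbb{R}^m$. Steps: 1. Set $k$ vectors $\bar{p}_1,\dots,\bar{p}_k$ of distinct indices partitioning $\{1,\dots,m\}$. 2. Compute the Moore-Penrose pseudoinverses $\mathsf{G}^+$, $\mathsf{L}^+$ (both $n\times m$). 3. Compute $\bar{c}=\mathsf{G}^+\bar{g}$. 4. Compute $\bar{f}=\mathsf{L}\bar{c}$. 5. For $\ell=1,\dots,k$ compute $\bar{\alpha}_{\bar{p}_\ell}=((\mathsf{L}^{+})_{:,\bar{p}_\ell})^+(\mathsf{G}^{+})_{:,\bar{p}_\ell}((\mathsf{G}^{+})_{\bar{p}_\ell,\bar{p}_\ell})^{-1}\bar{c}_{\bar{p}_\ell}$ (the inverses being assumed to exist). 6. Assemble $\bar{\alpha}\in\mathbb{R}^m$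 from $\bar{\alpha}_{\bar{p}_1},\dots,\bar{\alpha}_{\bar{p}_k}$. 7. Compute $\bar{\epsilon}=\bar{\alpha}-\bar{f}+\bar{h}$. Here $\mathsf{A}_{:,\bar{p}}$ is the submatrix of columns with index in $\bar{p}$, $\mathsf{A}_{\bar{p},\bar{p}}$ the submatrix of rows and columns with index in $\bar{p}$, $\bar{z}_{\bar{p}}$ the subvector of entries with index in $\bar{p}$. Cost model: number of arithmetic operations with standard dense linear algebra: multiplying an $a\times b$ by a $b\times c$ matrix costs $\mathcal{O}(abc)$; inverting an $a\times a$ matrix costs $\mathcal{O}(a^3)$; computing the pseudoinverse of an $a\times b$ matrix (via singular value decomposition) costs $\mathcal{O}(ab\min(a,b))$. *)

theory Defs
  imports
    "Jordan_Normal_Form.Gauss_Jordan_Elimination"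
    "HOL-Library.Landau_Symbols"
    "HOL-Library.Monad_Syntax"
begin

section \<open>Moore-Penrose pseudoinverse and submatrices\<close>

definition moore_penrose :: "real mat \<Rightarrow> real mat \<Rightarrow> bool" where
  "moore_penrose A X \<longleftrightarrow>
     X \<in> carrier_mat (dim_col A) (dim_row A) \<and>
     A * X * A = A \<and> X * A * X = X \<and>
     transpose_mat (A * X) = A * X \<and> transpose_mat (X * A) = X * A"

definition pinv :: "real mat \<Rightarrow> real mat" where
  "pinv A = (THE X. moore_penrose A X)"

text \<open>Index vectors are lists; indices are counted from 0, so that \<open>{1, \<dots>, m}\<close> becomes \<open>{..<m}\<close>.\<close>

definition cols_sub :: "'a mat \<Rightarrow> nat list \<Rightarrow> 'a mat" where
  "cols_sub A p = mat (dim_row A) (length p) (\<lambda>(i, j). A $$ (i, p ! j))"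

definition block_sub :: "'a mat \<Rightarrow> nat list \<Rightarrow> 'a mat" where
  "block_sub A p = mat (length p) (length p) (\<lambda>(i, j). A $$ (p ! i, p ! j))"

definition vec_sub :: "'a vec \<Rightarrow> nat list \<Rightarrow> 'a vec" where
  "vec_sub z p = vec (length p) (\<lambda>i. z $ (p ! i))"

text \<open>The vector whose subvector with indices \<open>ps ! l\<close> is \<open>zs ! l\<close>.\<close>

definition assemble :: "nat \<Rightarrow> nat list list \<Rightarrow> 'a vec list \<Rightarrow> 'a vec" where
  "assemble m ps zs =
     vec m (\<lambda>i. the (map_of (zip (concat ps) (concat (map list_of_vec zs))) i))"


section \<open>Cost model\<close>

text \<open>
  The costs of the matrix kernels are left open as functions of the dimensions: for dimensions
  \<open>a\<close>, \<open>b\<close>, \<open>c\<close> these are the numbers of arithmetic operations for multiplying an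
  \<open>a \<times> b\<close> by a \<open>b \<times> c\<close> matrix, inverting an \<open>a \<times> a\<close> matrix, and computing the pseudoinverse
  of an \<open>a \<times> b\<close> matrix.
\<close>

record cost_model =
  mult_cost :: "nat \<Rightarrow> nat \<Rightarrow> nat \<Rightarrow> nat"
  inv_cost :: "nat \<Rightarrow> nat"
  pinv_cost :: "nat \<Rightarrow> nat \<Rightarrow> nat"

text \<open>
  Over a principal filter \<open>principal S\<close>, the Landau symbol means a bound with a single constant
  that is valid on all of \<open>S\<close>, with no restriction to large parameters.
\<close>

definition dense_cost_model :: "cost_model \<Rightarrow> bool" where
  "dense_cost_model cm \<longleftrightarrow>
     (\<lambda>(a, b, c). real (mult_cost cm a b c))
       \<in> O[principal {(a, b, c). 0 < a \<and> 0 < b \<and> 0 < c}](\<lambda>(a, b, c). real (a * b * c)) \<and>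
     (\<lambda>a. real (inv_cost cm a))
       \<in> O[principal {a. 0 < a}](\<lambda>a. real (a ^ 3)) \<and>
     (\<lambda>(a, b). real (pinv_cost cm a b))
       \<in> O[principal {(a, b). 0 < a \<and> 0 < b}](\<lambda>(a, b). real (a * b * min a b))"

text \<open>A computation yields its result and the number of arithmetic operations performed.\<close>

type_synonym 'a counted = "'a \<times> nat"

definition return_counted :: "'a \<Rightarrow> 'a counted" where
  "return_counted x = (x, 0)"

definition bind_counted :: "'a counted \<Rightarrow> ('a \<Rightarrow> 'b counted) \<Rightarrow> 'b counted" where
  "bind_counted s f = (fst (f (fst s)), snd s + snd (f (fst s)))"

adhoc_overloading Monad_Syntax.bind \<rightleftharpoons> bind_counted

primrec map_counted :: "('a \<Rightarrow> 'b counted) \<Rightarrow> 'a list \<Rightarrow> 'b list counted" where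
  "map_counted f [] = return_counted []"
| "map_counted f (x # xs) =
     do { y \<leftarrow> f x; ys \<leftarrow> map_counted f xs; return_counted (y # ys) }"

definition mult_mat_op :: "cost_model \<Rightarrow> real mat \<Rightarrow> real mat \<Rightarrow> real mat counted" where
  "mult_mat_op cm A B = (A * B, mult_cost cm (dim_row A) (dim_col A) (dim_col B))"

definition mult_vec_op :: "cost_model \<Rightarrow> real mat \<Rightarrow> real vec \<Rightarrow> real vec counted" where
  "mult_vec_op cm A z = (A *\<^sub>v z, mult_cost cm (dim_row A) (dim_col A) 1)"

definition inv_op :: "cost_model \<Rightarrow> real mat \<Rightarrow> real mat counted" where
  "inv_op cm A = (the (mat_inverse A), inv_cost cm (dim_row A))"

definition pinv_op :: "cost_model \<Rightarrow> real mat \<Rightarrow> real mat counted" where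
  "pinv_op cm A = (pinv A, pinv_cost cm (dim_row A) (dim_col A))"

definition add_vec_op :: "real vec \<Rightarrow> real vec \<Rightarrow> real vec counted" where
  "add_vec_op y z = (y + z, dim_vec z)"

definition minus_vec_op :: "real vec \<Rightarrow> real vec \<Rightarrow> real vec counted" where
  "minus_vec_op y z = (y - z, dim_vec z)"


section \<open>The surrogate $k$-fold CV algorithm\<close>

text \<open>
  The choice of the index vectors \<open>ps\<close> is an argument. Choosing them, extracting
  submatrices and subvectors, and assembling a vector take no arithmetic operations. The
  product of four factors for each fold is evaluated from left to right.
\<close>

definition fold_coeffs ::
  "cost_model \<Rightarrow> real mat \<Rightarrow> real mat \<Rightarrow> real vec \<Rightarrow> nat list \<Rightarrow> real vec counted" where
  "fold_coeffs cm Gp Lp c p = do {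
     P \<leftarrow> pinv_op cm (cols_sub Lp p);
     V \<leftarrow> inv_op cm (block_sub Gp p);
     A \<leftarrow> mult_mat_op cm P (cols_sub Gp p);
     B \<leftarrow> mult_mat_op cm A V;
     mult_vec_op cm B (vec_sub c p)
   }"

definition surrogate_cv ::
  "cost_model \<Rightarrow> real mat \<Rightarrow> real mat \<Rightarrow> real vec \<Rightarrow> real vec \<Rightarrow> nat list list \<Rightarrow> real vec counted"
where
  "surrogate_cv cm G L g h ps = do {
     Gp \<leftarrow> pinv_op cm G;
     Lp \<leftarrow> pinv_op cm L;
     c \<leftarrow> mult_vec_op cm Gp g;
     f \<leftarrow> mult_vec_op cm L c;
     \<alpha>s \<leftarrow> map_counted (fold_coeffs cm Gp Lp c) ps;
     let \<alpha> = assemble (dim_row G) ps \<alpha>s;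
     d \<leftarrow> minus_vec_op \<alpha> f;
     add_vec_op d h
   }"

definition surrogate_cv_cost ::
  "cost_model \<Rightarrow> real mat \<Rightarrow> real mat \<Rightarrow> real vec \<Rightarrow> real vec \<Rightarrow> nat list list \<Rightarrow> nat" where
  "surrogate_cv_cost cm G L g h ps = snd (surrogate_cv cm G L g h ps)"

definition index_partition :: "nat \<Rightarrow> nat \<Rightarrow> nat list list \<Rightarrow> bool" where
  "index_partition m k ps \<longleftrightarrow>
     length ps = k \<and> distinct (concat ps) \<and> set (concat ps) = {..<m}"

text \<open>Admissible inputs with their size parameters and a choice of index vectors of equal length.\<close>

definition cv_inputs ::
  "(nat \<times> nat \<times> nat \<times> real mat \<times> real mat \<times> real vec \<times> real vec \<times> nat list list) set" where
  "cv_inputs = {(m, n, k, G, L, g, h, ps).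
     0 < m \<and> m \<le> n \<and> 0 < k \<and> k \<le> m \<and>
     G \<in> carrier_mat m n \<and> L \<in> carrier_mat m n \<and> g \<in> carrier_vec m \<and> h \<in> carrier_vec m \<and>
     index_partition m k ps \<and>
     (\<exists>v :: nat. real v = real m / real k \<and> (\<forall>p \<in> set ps. length p = v)) \<and>
     (\<forall>p \<in> set ps. invertible_mat (block_sub (pinv G) p))}"

end

theory Submission
  imports Defs
begin

text \<open>
  The operation count depends on the inputs only through the dimensions of the intermediate
  matrices. If every fold has \<open>v = m / k\<close> indices, then, up to constants,
  \<^item> the two pseudoinverses of \<open>m \<times> n\<close> matrices cost \<open>m\<^sup>2 n\<close> each, the two products with a vector
    cost \<open>m n\<close> each, and the final addition and subtraction cost \<open>m\<close> each; as \<open>m \<le> n\<close>, all of this is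
    \<open>O(m n\<^sup>2)\<close>;
  \<^item> each fold costs \<open>n v\<^sup>2\<close> for the pseudoinverse of an \<open>n \<times> v\<close> matrix and for the product of a
    \<open>v \<times> n\<close> by an \<open>n \<times> v\<close> matrix, and at most \<open>v\<^sup>3\<close> for each of the remaining steps, which act
    on \<open>v \<times> v\<close> matrices. The \<open>k\<close> folds together cost \<open>k v\<^sup>3 + k n v\<^sup>2 = m\<^sup>3 / k\<^sup>2 + m\<^sup>2 n / k\<close>, which are the
    first two summands of the second bound.

  The mathematical content behind the dimensions is that \<open>pinv A\<close>, a definite description,
  really denotes an \<open>n \<times> m\<close> matrix, that is, that every real matrix has exactly one Moore-Penrose
  pseudoinverse (\<open>moore_penrose_exists\<close>, \<open>moore_penrose_unique\<close>). For existence, the reduced row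
  echelon form yields a matrix \<open>H\<close> with \<open>M H M = M\<close> for the Gram matrix \<open>M = A\<^sup>T A\<close>. Then
  \<open>B = H A\<^sup>T\<close> satisfies \<open>A B A = A\<close> with \<open>A B\<close> symmetric. Applying this to \<open>A\<^sup>T\<close> too gives \<open>D\<close> with
  \<open>A D A = A\<close> and \<open>D A\<close> symmetric, and \<open>D A B\<close> is the pseudoinverse.
\<close>

section \<open>Existence and uniqueness of the Moore-Penrose pseudoinverse\<close>

text \<open>
  In reduced row echelon form the pivot columns are unit vectors. The matrix that moves
  coordinate \<open>i\<close> to the pivot position of row \<open>i\<close> therefore selects these columns, and \<open>R * G\<close> is the
  projection onto the coordinates of the nonzero rows of \<open>R\<close>, which fixes \<open>R\<close>.
\<close>

lemma row_echelon_inner_inverse: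
  fixes R :: "'a :: field mat"
  assumes R: "R \<in> carrier_mat nr nc" and echelon: "row_echelon_form R"
  shows "\<exists>G \<in> carrier_mat nc nr. R * G * R = R"
proof -
  obtain f where "pivot_fun R f nc"
    using echelon R unfolding row_echelon_form_def by auto
  note pivot = pivot_funD[OF carrier_matD(1)[OF R] this]
  \<comment> \<open>A zero row \<open>i\<close> has \<open>f i = nc\<close>, which is not a row index of \<open>G\<close>, so column \<open>i\<close> of \<open>G\<close> is zero.\<close>
  define G :: "'a mat" where "G = mat nc nr (\<lambda>(j, i). if j = f i then 1 else 0)"
  have G: "G \<in> carrier_mat nc nr"
    unfolding G_def by simp
  have RG: "(R * G) $$ (i', i) = (if i = i' \<and> f i < nc then 1 else 0)"
    if "i' < nr" "i < nr" for i' i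
  proof -
    have "(R * G) $$ (i', i) = (\<Sum>j\<in>{0..<nc}. R $$ (i', j) * (if j = f i then 1 else 0))"
      using that R G by (simp add: scalar_prod_def G_def)
    also have "\<dots> = (if f i < nc then R $$ (i', f i) else 0)"
      by (simp add: if_distrib[of "(*) _"] sum.delta cong: if_cong)
    finally show ?thesis
      using pivot(4,5) that by auto
  qed
  have "R * G * R = R"
  proof (rule eq_matI)
    fix i j assume "i < dim_row R" "j < dim_col R"
    then have ij: "i < nr" "j < nc" using R by auto
    have "(R * G * R) $$ (i, j) = (\<Sum>l\<in>{0..<nr}. (R * G) $$ (i, l) * R $$ (l, j))"
      using ij R G by (simp add: scalar_prod_def del: assoc_mult_mat)
    also have "\<dots> = (\<Sum>l\<in>{0..<nr}. if l = i then (if f i < nc then R $$ (l, j) else 0) else 0)"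
      using ij by (intro sum.cong) (auto simp: RG)
    also have "\<dots> = (if f i < nc then R $$ (i, j) else 0)"
      using ij by simp
    also have "\<dots> = R $$ (i, j)"
      using pivot(1,2) ij by (metis le_neq_implies_less)
    finally show "(R * G * R) $$ (i, j) = R $$ (i, j)" .
  qed (use R G in auto)
  with G show ?thesis by blast
qed

text \<open>
  Gauss-Jordan elimination gives \<open>R = P A\<close> with \<open>P\<close> invertible; if \<open>G\<close> is an inner inverse of \<open>R\<close>, then
  \<open>G P\<close> is one of \<open>A\<close>.
\<close>

lemma inner_inverse_exists:
  fixes A :: "'a :: field mat"
  assumes A: "A \<in> carrier_mat nr nc"
  shows "\<exists>G \<in> carrier_mat nc nr. A * G * A = A"
proof -
  define R where "R = gauss_jordan_single A"
  note gj = gauss_jordan_single[OF A R_def[symmetric]]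
  obtain P Q where PQ: "R = P * A" "P \<in> carrier_mat nr nr" "Q \<in> carrier_mat nr nr" "Q * P = 1\<^sub>m nr"
    using gj(4) by auto
  obtain G where G: "G \<in> carrier_mat nc nr" "R * G * R = R"
    using row_echelon_inner_inverse[OF gj(2,3)] by auto
  have QR: "Q * R = A"
    using assoc_mult_mat[OF PQ(3,2) A] PQ(1,4) A by simp
  have "A * (G * P) * A = (Q * R) * (G * P) * A"
    by (simp only: QR)
  also have "\<dots> = Q * (R * G * (P * A))"
    using PQ(2,3) A G(1) gj(2)
    by (simp add: assoc_mult_mat[of Q nr nr _ nc _ nr] assoc_mult_mat[of Q nr nr _ nr A nc]
        assoc_mult_mat[of R nr nc _ nr A nc] assoc_mult_mat[of G nc nr P nr A nc]
        assoc_mult_mat[of R nr nc G nr _ nc])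
  also have "\<dots> = A"
    using G(2) QR PQ(1) by simp
  finally show ?thesis
    using G(1) PQ(2) by (intro bexI[of _ "G * P"]) auto
qed

text \<open>
  The diagonal entries of a Gram matrix are sums of squares. This is where the entries have to be
  real.
\<close>

lemma gram_zero_imp_zero:
  fixes W :: "real mat"
  assumes "transpose_mat W * W = 0\<^sub>m (dim_col W) (dim_col W)"
  shows "W = 0\<^sub>m (dim_row W) (dim_col W)"
proof (rule eq_matI)
  fix i j assume "i < dim_row (0\<^sub>m (dim_row W) (dim_col W) :: real mat)"
    "j < dim_col (0\<^sub>m (dim_row W) (dim_col W) :: real mat)"
  then have ij: "i < dim_row W" "j < dim_col W" by auto
  have "(\<Sum>l\<in>{0..<dim_row W}. W $$ (l, j) * W $$ (l, j)) = (transpose_mat W * W) $$ (j, j)"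
    using ij by (simp add: scalar_prod_def)
  also have "\<dots> = 0"
    using ij by (simp add: assms)
  finally have "\<forall>l\<in>{0..<dim_row W}. W $$ (l, j) * W $$ (l, j) = 0"
    by (subst (asm) sum_nonneg_eq_0_iff) auto
  then show "W $$ (i, j) = 0\<^sub>m (dim_row W) (dim_col W) $$ (i, j)"
    using ij by auto
qed auto

text \<open>
  \<open>A\<^sup>T A\<close> and \<open>A\<close> have the same kernel: if \<open>A\<^sup>T A U = 0\<close>, then the Gram matrix of \<open>A U\<close> vanishes.
\<close>

lemma gram_left_cancel:
  fixes A :: "real mat"
  assumes A: "A \<in> carrier_mat m n" and Y: "Y \<in> carrier_mat n p" and Z: "Z \<in> carrier_mat n p"
    and eq: "transpose_mat A * A * Y = transpose_mat A * A * Z"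
  shows "A * Y = A * Z"
proof -
  have At: "transpose_mat A \<in> carrier_mat n m" using A by simp
  define U where "U = Y - Z"
  have U: "U \<in> carrier_mat n p" using Y Z unfolding U_def by auto
  define W where "W = A * U"
  have W: "W \<in> carrier_mat m p" using A U unfolding W_def by auto
  have "transpose_mat A * W = transpose_mat A * A * U"
    unfolding W_def using assoc_mult_mat[OF At A U] by simp
  also have "\<dots> = transpose_mat A * A * Y - transpose_mat A * A * Z"
    unfolding U_def using At A Y Z by (intro mult_minus_distrib_mat) auto
  also have "\<dots> = 0\<^sub>m n p"
    using At A Z unfolding eq by (intro minus_r_inv_mat) auto
  finally have AtW: "transpose_mat A * W = 0\<^sub>m n p" .
  have "transpose_mat W * W = transpose_mat U * (transpose_mat A * W)"
    using transpose_mult[OF A U] U At W unfolding W_def[symmetric]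
    by (simp add: assoc_mult_mat[of _ p n _ m _ p])
  then have "transpose_mat W * W = 0\<^sub>m p p"
    using U by (simp add: AtW)
  then have "W = 0\<^sub>m m p"
    using gram_zero_imp_zero[of W] W by auto
  moreover have "W = A * Y - A * Z"
    unfolding W_def U_def using A Y Z by (intro mult_minus_distrib_mat) auto
  ultimately have "(A * Y - A * Z) $$ (i, j) = 0" if "i < m" "j < p" for i j
    using that by simp
  then show ?thesis
    using A Y Z by (intro eq_matI) auto
qed

text \<open>
  Here \<open>B b\<close> is a least-squares solution of \<open>A x = b\<close>, i.e. \<open>A B\<close> is the orthogonal projection onto the
  column space of \<open>A\<close>. With an inner inverse \<open>H\<close> of \<open>A\<^sup>T A\<close>, the matrix \<open>H A\<^sup>T\<close> solves the normal equations
  \<open>A\<^sup>T A B = A\<^sup>T\<close>.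
\<close>

lemma least_squares_inverse_exists:
  fixes A :: "real mat"
  assumes A: "A \<in> carrier_mat m n"
  shows "\<exists>B \<in> carrier_mat n m. A * B * A = A \<and> transpose_mat (A * B) = A * B"
proof -
  have At: "transpose_mat A \<in> carrier_mat n m" using A by simp
  define M where "M = transpose_mat A * A"
  have M: "M \<in> carrier_mat n n" using A At unfolding M_def by simp
  have Mt: "transpose_mat M = M"
    unfolding M_def using transpose_mult[OF At A] by simp
  obtain H where H: "H \<in> carrier_mat n n" and MHM: "M * H * M = M"
    using inner_inverse_exists[OF M] by auto
  have cancel: "A * (K * M) = A" if K: "K \<in> carrier_mat n n" and MKM: "M * K * M = M" for K
  proof -
    have "M * (K * M) = M * 1\<^sub>m n"
      using MKM M K by simp
    then have "A * (K * M) = A * 1\<^sub>m n"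
      unfolding M_def using A K At by (intro gram_left_cancel[of A m n _ n]) auto
    then show ?thesis using A by simp
  qed
  have Ht: "transpose_mat H \<in> carrier_mat n n" using H by simp
  \<comment> \<open>The transpose of an inner inverse of the symmetric matrix \<open>M\<close> is again one.\<close>
  have "transpose_mat (M * H * M) = M * (transpose_mat H * M)"
    using transpose_mult[OF mult_carrier_mat[OF M H] M] transpose_mult[OF M H] Mt by simp
  then have "M * transpose_mat H * M = M"
    using MHM Mt assoc_mult_mat[OF M Ht M] by simp
  then have "A * (transpose_mat H * M) = A" by (rule cancel[OF Ht])
  moreover have "transpose_mat (A * (transpose_mat H * M)) = M * H * transpose_mat A"
    using transpose_mult[OF A mult_carrier_mat[OF Ht M]] transpose_mult[OF Ht M] Mt by simp
  ultimately have At_eq: "M * H * transpose_mat A = transpose_mat A" by simp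
  define B where "B = H * transpose_mat A"
  have B: "B \<in> carrier_mat n m" using H At unfolding B_def by simp
  have "B * A = H * M"
    unfolding B_def M_def using assoc_mult_mat[OF H At A] .
  then have ABA: "A * B * A = A"
    using cancel[OF H MHM] assoc_mult_mat[OF A B A] by simp
  \<comment> \<open>By the normal equations \<open>(A B)\<^sup>T (A B) = (A B)\<^sup>T\<close>; the left-hand side is symmetric.\<close>
  have "transpose_mat (A * B) * (A * B) = transpose_mat B * (M * B)"
    using transpose_mult[OF A B] A B At M unfolding M_def
    by (simp add: assoc_mult_mat[of _ m n _ m _ m] assoc_mult_mat[of _ n m _ n _ m])
  also have "M * B = transpose_mat A"
    unfolding B_def using At_eq assoc_mult_mat[OF M H At] by simp
  also have "transpose_mat B * transpose_mat A = transpose_mat (A * B)"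
    using transpose_mult[OF A B] by simp
  finally have PtP: "transpose_mat (A * B) * (A * B) = transpose_mat (A * B)" .
  have AB: "A * B \<in> carrier_mat m m" using A B by simp
  have "transpose_mat (transpose_mat (A * B) * (A * B)) = transpose_mat (A * B) * (A * B)"
    using transpose_mult[of "transpose_mat (A * B)" m m "A * B" m] AB by simp
  then have "transpose_mat (A * B) = A * B"
    unfolding PtP by simp
  with B ABA show ?thesis by blast
qed

text \<open>
  A least-squares inverse \<open>B\<close> has the right projection \<open>A B\<close>, and the transpose \<open>D\<close> of one of \<open>A\<^sup>T\<close> has
  the right projection \<open>D A\<close>. Urquhart's product \<open>D A B\<close> inherits both: \<open>A (D A B) = A B\<close> and
  \<open>(D A B) A = D A\<close>.
\<close>

lemma moore_penrose_exists:
  fixes A :: "real mat"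
  assumes A: "A \<in> carrier_mat m n"
  shows "\<exists>X. moore_penrose A X"
proof -
  obtain B where B: "B \<in> carrier_mat n m" and ABA: "A * B * A = A"
    and AB: "transpose_mat (A * B) = A * B"
    using least_squares_inverse_exists[OF A] by auto
  have At: "transpose_mat A \<in> carrier_mat n m" using A by simp
  obtain C where C: "C \<in> carrier_mat m n"
    and C1: "transpose_mat A * C * transpose_mat A = transpose_mat A"
    and C2: "transpose_mat (transpose_mat A * C) = transpose_mat A * C"
    using least_squares_inverse_exists[OF At] by auto
  define D where "D = transpose_mat C"
  have D: "D \<in> carrier_mat n m" using C unfolding D_def by simp
  have Ct: "C = transpose_mat D" unfolding D_def by simp
  have AtC: "transpose_mat A * C = transpose_mat (D * A)"
    unfolding Ct using transpose_mult[OF D A] by simp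
  have DA: "transpose_mat (D * A) = D * A"
    using C2 unfolding AtC by simp
  have "transpose_mat (transpose_mat (D * A) * transpose_mat A) = A * (D * A)"
    using transpose_mult[of "transpose_mat (D * A)" n n "transpose_mat A" m] D A by simp
  then have ADA: "A * (D * A) = A"
    using C1 unfolding AtC by simp
  define X where "X = D * (A * B)"
  have X: "X \<in> carrier_mat n m" using A B D unfolding X_def by auto
  have AX: "A * X = A * B"
    unfolding X_def using A B D ADA assoc_mult_mat[of A m n "D * A" n B m] assoc_mult_mat[OF D A B]
    by simp
  have XA: "X * A = D * A"
    unfolding X_def using ABA assoc_mult_mat[OF D mult_carrier_mat[OF A B] A] by simp
  have "X * A * X = D * (A * X)"
    unfolding XA using assoc_mult_mat[OF D A X] .
  also have "\<dots> = X"
    unfolding AX by (rule X_def[symmetric])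
  finally have "X * A * X = X" .
  moreover have "A * X * A = A" unfolding AX by (rule ABA)
  ultimately have "moore_penrose A X"
    unfolding moore_penrose_def using A X AX XA AB DA by simp
  then show ?thesis ..
qed

text \<open>
  \<open>A X\<close> and \<open>A Y\<close> are both the orthogonal projection onto the column space of \<open>A\<close>, and \<open>X A\<close> and \<open>Y A\<close> are
  both the one onto its row space. Hence \<open>X = X A X = Y A X = Y A Y = Y\<close>.
\<close>

lemma moore_penrose_unique:
  assumes X: "moore_penrose A X" and Y: "moore_penrose A Y"
  shows "X = Y"
proof -
  define m n where "m = dim_row A" and "n = dim_col A"
  have cA: "A \<in> carrier_mat m n" unfolding m_def n_def by auto
  have cX: "X \<in> carrier_mat n m" and X1: "A * X * A = A" and X2: "X * A * X = X"
    and X3: "transpose_mat (A * X) = A * X" and X4: "transpose_mat (X * A) = X * A"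
    using X unfolding moore_penrose_def m_def n_def by auto
  have cY: "Y \<in> carrier_mat n m" and Y1: "A * Y * A = A" and Y2: "Y * A * Y = Y"
    and Y3: "transpose_mat (A * Y) = A * Y" and Y4: "transpose_mat (Y * A) = Y * A"
    using Y unfolding moore_penrose_def m_def n_def by auto
  have AXY: "(A * X) * (A * Y) = A * Y" "(A * Y) * (A * X) = A * X"
    using assoc_mult_mat[OF mult_carrier_mat[OF cA cX] cA cY] X1
      assoc_mult_mat[OF mult_carrier_mat[OF cA cY] cA cX] Y1 by simp_all
  have XYA: "(X * A) * (Y * A) = X * A" "(Y * A) * (X * A) = Y * A"
    using assoc_mult_mat[OF cX cA mult_carrier_mat[OF cY cA]] assoc_mult_mat[OF cA cY cA] Y1
      assoc_mult_mat[OF cY cA mult_carrier_mat[OF cX cA]] assoc_mult_mat[OF cA cX cA] X1 by simp_all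
  have "A * X = transpose_mat ((A * Y) * (A * X))"
    using AXY(2) X3 by simp
  also have "\<dots> = (A * X) * (A * Y)"
    using transpose_mult[of "A * Y" m m "A * X" m] cA cX cY X3 Y3 by simp
  finally have AXAY: "A * X = A * Y" using AXY(1) by simp
  have "X * A = transpose_mat ((X * A) * (Y * A))"
    using XYA(1) X4 by simp
  also have "\<dots> = (Y * A) * (X * A)"
    using transpose_mult[of "X * A" n n "Y * A" n] cA cX cY X4 Y4 by simp
  finally have XAYA: "X * A = Y * A" using XYA(2) by simp
  have "X = Y * A * X" using X2 XAYA by simp
  also have "\<dots> = Y * (A * Y)" using assoc_mult_mat[OF cY cA cX] AXAY by simp
  also have "\<dots> = Y" using assoc_mult_mat[OF cY cA cY] Y2 by simp
  finally show ?thesis .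
qed

lemma moore_penrose_pinv: "moore_penrose A (pinv A)"
proof -
  obtain X where X: "moore_penrose A X"
    using moore_penrose_exists[of A "dim_row A" "dim_col A"] by auto
  show ?thesis
    unfolding pinv_def
    by (rule theI[of "moore_penrose A", OF X]) (rule moore_penrose_unique[OF _ X])
qed

lemma dim_pinv [simp]:
  "dim_row (pinv A) = dim_col A" "dim_col (pinv A) = dim_row A"
  using moore_penrose_pinv[of A] unfolding moore_penrose_def by auto

section \<open>The exact cost of the algorithm\<close>

text \<open>
  Without invertibility the selected option value would be unspecified, and so would its
  dimensions, on which the cost of the products in a fold depends.
\<close>

lemma dim_col_mat_inverse:
  fixes A :: "'a :: field mat"
  assumes "invertible_mat A"
  shows "dim_col (the (mat_inverse A)) = dim_row A"
proof -
  define n where "n = dim_row A"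
  have A: "A \<in> carrier_mat n n"
    using assms unfolding invertible_mat_def n_def by auto
  obtain B where AB: "A * B = 1\<^sub>m n" and BA: "B * A = 1\<^sub>m (dim_row B)"
    using assms unfolding invertible_mat_def inverts_mat_def n_def by auto
  have "dim_col (A * B) = n" "dim_col (B * A) = dim_row B"
    by (simp_all only: AB BA index_one_mat)
  then have "B \<in> carrier_mat n n" using A by auto
  with A AB BA have "A \<in> Units (ring_mat TYPE('a) n ())"
    unfolding Units_def ring_mat_def by auto
  then obtain C where "mat_inverse A = Some C"
    using mat_inverse(1)[OF A, where b = "()"] by (cases "mat_inverse A") auto
  then show ?thesis
    using mat_inverse(2)[OF A] A by auto
qed

lemma snd_map_counted_const:
  assumes "\<And>x. x \<in> set xs \<Longrightarrow> snd (f x) = c"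
  shows "snd (map_counted f xs) = length xs * c"
  using assms by (induction xs) (auto simp: bind_counted_def return_counted_def)

definition fold_cost :: "cost_model \<Rightarrow> nat \<Rightarrow> nat \<Rightarrow> nat" where
  "fold_cost cm n v =
     pinv_cost cm n v + inv_cost cm v + mult_cost cm v n v + mult_cost cm v v v + mult_cost cm v v 1"

definition setup_cost :: "cost_model \<Rightarrow> nat \<Rightarrow> nat \<Rightarrow> nat" where
  "setup_cost cm m n = 2 * pinv_cost cm m n + mult_cost cm n m 1 + mult_cost cm m n 1 + 2 * m"

lemma snd_fold_coeffs:
  assumes "dim_row Gp = n" "dim_row Lp = n" "invertible_mat (block_sub Gp p)"
  shows "snd (fold_coeffs cm Gp Lp c p) = fold_cost cm n (length p)"
  using assms(1,2) dim_col_mat_inverse[OF assms(3)]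
  by (simp add: fold_coeffs_def fold_cost_def bind_counted_def pinv_op_def inv_op_def mult_mat_op_def
      mult_vec_op_def cols_sub_def block_sub_def)

lemma surrogate_cv_cost_eq:
  assumes "(m, n, k, G, L, g, h, ps) \<in> cv_inputs"
  shows "surrogate_cv_cost cm G L g h ps = setup_cost cm m n + k * fold_cost cm n (m div k)"
proof -
  obtain v where v: "real v = real m / real k" "\<forall>p \<in> set ps. length p = v"
    using assms unfolding cv_inputs_def by auto
  have dims: "G \<in> carrier_mat m n" "L \<in> carrier_mat m n" "h \<in> carrier_vec m" "0 < k"
    and inv: "\<forall>p \<in> set ps. invertible_mat (block_sub (pinv G) p)" and len: "length ps = k"
    using assms unfolding cv_inputs_def index_partition_def by auto
  have "real (v * k) = real m" using v(1) dims(4) by simp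
  then have "v * k = m" by (simp only: of_nat_eq_iff)
  then have "m div k = v" using dims(4) by auto
  then have "snd (map_counted (fold_coeffs cm (pinv G) (pinv L) c) ps) = k * fold_cost cm n (m div k)" for c
    using v(2) inv dims len
    by (subst snd_map_counted_const[where c = "fold_cost cm n v"]) (auto simp: snd_fold_coeffs)
  then show ?thesis
    using dims
    by (simp add: surrogate_cv_cost_def surrogate_cv_def bind_counted_def pinv_op_def mult_vec_op_def
        minus_vec_op_def add_vec_op_def Let_def setup_cost_def)
qed

section \<open>Asymptotic bounds\<close>

lemma bigo_principal_iff:
  "f \<in> O[principal S](g) \<longleftrightarrow> (\<exists>c>0. \<forall>x\<in>S. norm (f x) \<le> c * norm (g x))"
  unfolding bigo_def eventually_principal by auto

text \<open>
  One constant can serve for all three kernels, since only the orders of magnitude matter.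
\<close>

lemma dense_cost_modelE:
  assumes "dense_cost_model cm"
  obtains C :: real where "C > 0"
    "\<And>a b c. 0 < a \<Longrightarrow> 0 < b \<Longrightarrow> 0 < c \<Longrightarrow> real (mult_cost cm a b c) \<le> C * real (a * b * c)"
    "\<And>a. 0 < a \<Longrightarrow> real (inv_cost cm a) \<le> C * real (a ^ 3)"
    "\<And>a b. 0 < a \<Longrightarrow> 0 < b \<Longrightarrow> real (pinv_cost cm a b) \<le> C * real (a * b * min a b)"
proof -
  obtain C1 where C1: "C1 > 0" "\<And>x. x \<in> {(a, b, c). 0 < a \<and> 0 < b \<and> 0 < c} \<Longrightarrow>
      norm (case x of (a, b, c) \<Rightarrow> real (mult_cost cm a b c)) \<le>
        C1 * norm (case x of (a, b, c) \<Rightarrow> real (a * b * c))"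
    using assms unfolding dense_cost_model_def bigo_principal_iff by blast
  obtain C2 where C2: "C2 > 0" "\<And>a. a \<in> {a. 0 < a} \<Longrightarrow>
      norm (real (inv_cost cm a)) \<le> C2 * norm (real (a ^ 3))"
    using assms unfolding dense_cost_model_def bigo_principal_iff by blast
  obtain C3 where C3: "C3 > 0" "\<And>x. x \<in> {(a, b). 0 < a \<and> 0 < b} \<Longrightarrow>
      norm (case x of (a, b) \<Rightarrow> real (pinv_cost cm a b)) \<le>
        C3 * norm (case x of (a, b) \<Rightarrow> real (a * b * min a b))"
    using assms unfolding dense_cost_model_def bigo_principal_iff by blast
  have *: "x \<le> (C1 + C2 + C3) * real y"
    if "x \<le> C' * real y" "C' \<le> C1 + C2 + C3" for x C' y
    using order_trans[OF that(1) mult_right_mono[OF that(2)]] by simp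
  show thesis
  proof (rule that[of "C1 + C2 + C3"])
    fix a b c :: nat assume "0 < a" "0 < b" "0 < c"
    then show "real (mult_cost cm a b c) \<le> (C1 + C2 + C3) * real (a * b * c)"
      using *[of _ C1 "a * b * c"] C1(2)[of "(a, b, c)"] C1(1) C2(1) C3(1) by simp
  next
    fix a :: nat assume "0 < a"
    then show "real (inv_cost cm a) \<le> (C1 + C2 + C3) * real (a ^ 3)"
      using *[of _ C2 "a ^ 3"] C2(2)[of a] C1(1) C2(1) C3(1) by simp
  next
    fix a b :: nat assume "0 < a" "0 < b"
    then show "real (pinv_cost cm a b) \<le> (C1 + C2 + C3) * real (a * b * min a b)"
      using *[of _ C3 "a * b * min a b"] C3(2)[of "(a, b)"] C1(1) C2(1) C3(1) by simp
  qed (use C1(1) C2(1) C3(1) in simp)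
qed

lemma setup_cost_le:
  assumes "dense_cost_model cm"
  shows "\<exists>c>0. \<forall>m n. 0 < m \<longrightarrow> m \<le> n \<longrightarrow> real (setup_cost cm m n) \<le> c * (real m * real n ^ 2)"
proof -
  obtain C :: real where C: "C > 0"
    and mult: "\<And>a b c. 0 < a \<Longrightarrow> 0 < b \<Longrightarrow> 0 < c \<Longrightarrow> real (mult_cost cm a b c) \<le> C * real (a * b * c)"
    and pinv: "\<And>a b. 0 < a \<Longrightarrow> 0 < b \<Longrightarrow> real (pinv_cost cm a b) \<le> C * real (a * b * min a b)"
    using dense_cost_modelE[OF assms] by metis
  have "real (setup_cost cm m n) \<le> (4 * C + 2) * (real m * real n ^ 2)"
    if "0 < m" "m \<le> n" for m n
  proof -
    have n: "0 < n" using that by simp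
    have mn: "m * n \<le> m * n ^ 2" "m \<le> m * n ^ 2" "m * n * min m n \<le> m * n ^ 2"
      using that by (auto simp: power2_eq_square)
    have scale: "C * real x \<le> C * real (m * n ^ 2)" if "x \<le> m * n ^ 2" for x
      using that C by (simp only: of_nat_le_iff mult_le_cancel_left_pos)
    have "real (pinv_cost cm m n) \<le> C * real (m * n ^ 2)"
      using pinv[OF that(1) n] scale[OF mn(3)] by simp
    moreover have "real (mult_cost cm n m 1) \<le> C * real (m * n ^ 2)"
      using mult[OF n that(1), of 1] scale[OF mn(1)] by (simp add: mult.commute)
    moreover have "real (mult_cost cm m n 1) \<le> C * real (m * n ^ 2)"
      using mult[OF that(1) n, of 1] scale[OF mn(1)] by simp
    moreover have "real m \<le> real (m * n ^ 2)"
      using mn(2) by (simp only: of_nat_le_iff)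
    ultimately have "real (setup_cost cm m n) \<le> (4 * C + 2) * real (m * n ^ 2)"
      unfolding setup_cost_def by (simp add: algebra_simps)
    then show ?thesis by simp
  qed
  then show ?thesis using C by (intro exI[of _ "4 * C + 2"]) auto
qed

lemma fold_cost_le:
  assumes "dense_cost_model cm"
  shows "\<exists>c>0. \<forall>n v. 0 < n \<longrightarrow> 0 < v \<longrightarrow>
    real (fold_cost cm n v) \<le> c * (real v ^ 3 + real n * real v ^ 2)"
proof -
  obtain C :: real where C: "C > 0"
    and mult: "\<And>a b c. 0 < a \<Longrightarrow> 0 < b \<Longrightarrow> 0 < c \<Longrightarrow> real (mult_cost cm a b c) \<le> C * real (a * b * c)"
    and inv: "\<And>a. 0 < a \<Longrightarrow> real (inv_cost cm a) \<le> C * real (a ^ 3)"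
    and pinv: "\<And>a b. 0 < a \<Longrightarrow> 0 < b \<Longrightarrow> real (pinv_cost cm a b) \<le> C * real (a * b * min a b)"
    using dense_cost_modelE[OF assms] by metis
  have "real (fold_cost cm n v) \<le> (3 * C) * (real v ^ 3 + real n * real v ^ 2)"
    if n: "0 < n" and v: "0 < v" for n v
  proof -
    have scale: "C * real x \<le> C * real y" if "x \<le> y" for x y
      using that C by (simp only: of_nat_le_iff mult_le_cancel_left_pos)
    have "real (pinv_cost cm n v) \<le> C * real (n * v ^ 2)"
      using pinv[OF n v] scale[of "n * v * min n v" "n * v ^ 2"] by (simp add: power2_eq_square)
    moreover have "real (inv_cost cm v) \<le> C * real (v ^ 3)"
      using inv[OF v] by simp
    moreover have "real (mult_cost cm v n v) \<le> C * real (n * v ^ 2)"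
      using mult[OF v n v] by (simp add: power2_eq_square mult_ac)
    moreover have "real (mult_cost cm v v v) \<le> C * real (v ^ 3)"
      using mult[OF v v v] by (simp add: power3_eq_cube)
    moreover have "real (mult_cost cm v v 1) \<le> C * real (v ^ 3)"
      using mult[OF v v, of 1] scale[of "v * v" "v ^ 3"] v by (simp add: power3_eq_cube)
    moreover have "0 \<le> C * real (n * v ^ 2)" using C by simp
    ultimately have "real (fold_cost cm n v) \<le> (3 * C) * (real (v ^ 3) + real (n * v ^ 2))"
      unfolding fold_cost_def by (simp add: algebra_simps)
    then show ?thesis by simp
  qed
  then show ?thesis using C by (intro exI[of _ "3 * C"]) auto
qed

theorem proposition4:
  fixes cm :: cost_model
  assumes "dense_cost_model cm"
  shows "\<exists>T1 T2.
    T1 \<in> O[principal cv_inputs](\<lambda>(m, n, k, _). real m * real n ^ 2) \<and>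
    T2 \<in> O[principal cv_inputs](\<lambda>(m, n, k, _).
      (real m ^ 3 + real m ^ 2 * real n * real k + real m * real n ^ 2 * real k ^ 2) / real k ^ 2) \<and>
    (\<forall>(m, n, k, G, L, g, h, ps) \<in> cv_inputs.
      real (surrogate_cv_cost cm G L g h ps) =
        T1 (m, n, k, G, L, g, h, ps) + T2 (m, n, k, G, L, g, h, ps))"
proof -
  obtain c1 where c1: "c1 > 0"
    "\<And>m n. 0 < m \<Longrightarrow> m \<le> n \<Longrightarrow> real (setup_cost cm m n) \<le> c1 * (real m * real n ^ 2)"
    using setup_cost_le[OF assms] by auto
  obtain c2 where c2: "c2 > 0" "\<And>n v. 0 < n \<Longrightarrow> 0 < v \<Longrightarrow>
      real (fold_cost cm n v) \<le> c2 * (real v ^ 3 + real n * real v ^ 2)"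
    using fold_cost_le[OF assms] by auto
  have folds: "real (k * fold_cost cm n (m div k)) \<le>
      c2 * ((real m ^ 3 + real m ^ 2 * real n * real k + real m * real n ^ 2 * real k ^ 2) / real k ^ 2)"
    if "(m, n, k, G, L, g, h, ps) \<in> cv_inputs" for m n k G L g h ps
  proof -
    have pos: "0 < k" "0 < m" "0 < n" and "\<exists>v :: nat. real v = real m / real k"
      using that unfolding cv_inputs_def by auto
    then obtain v :: nat where v: "real v = real m / real k" by auto
    then have "real (v * k) = real m" using pos by simp
    then have vk: "v * k = m" by (simp only: of_nat_eq_iff)
    then have "m div k = v" "0 < v" using pos by auto
    then have "real (k * fold_cost cm n (m div k)) \<le> k * (c2 * (real v ^ 3 + real n * real v ^ 2))"
      using c2(2)[OF pos(3), of v] by (simp add: mult_left_mono)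
    \<comment> \<open>Substituting \<open>v = m / k\<close> in \<open>k (v\<^sup>3 + n v\<^sup>2)\<close> gives the first two summands exactly.\<close>
    also have "\<dots> = c2 * ((real m ^ 3 + real m ^ 2 * real n * real k) / real k ^ 2)"
      unfolding v using pos by (simp add: field_simps power2_eq_square power3_eq_cube)
    also have "\<dots> \<le> c2 * ((real m ^ 3 + real m ^ 2 * real n * real k + real m * real n ^ 2 * real k ^ 2)
        / real k ^ 2)"
      using c2(1) by (intro mult_left_mono divide_right_mono) auto
    finally show ?thesis .
  qed
  let ?T1 = "\<lambda>(m, n, k, _). real (setup_cost cm m n)"
  let ?T2 = "\<lambda>(m, n, k, _). real (k * fold_cost cm n (m div k))"
  have "?T1 \<in> O[principal cv_inputs](\<lambda>(m, n, k, _). real m * real n ^ 2)"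
    unfolding bigo_principal_iff using c1
    by (intro exI[of _ c1]) (auto simp: cv_inputs_def)
  moreover have "?T2 \<in> O[principal cv_inputs](\<lambda>(m, n, k, _).
      (real m ^ 3 + real m ^ 2 * real n * real k + real m * real n ^ 2 * real k ^ 2) / real k ^ 2)"
    unfolding bigo_principal_iff using c2(1) folds
    by (intro exI[of _ c2]) (auto simp del: of_nat_mult)
  moreover have "\<forall>(m, n, k, G, L, g, h, ps) \<in> cv_inputs.
      real (surrogate_cv_cost cm G L g h ps) =
        ?T1 (m, n, k, G, L, g, h, ps) + ?T2 (m, n, k, G, L, g, h, ps)"
    by (auto simp: surrogate_cv_cost_eq)
  ultimately show ?thesis by blast
qed

end
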